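(* Let $d,m\geqslant 1$, let $f_0,f_1,\ldots,f_m:\mathbb{R}^d\to\mathbb{R}^d$ be globally Lipschitz continuous, and let $f(y,u)=f_0(y)+\sum_{j=1}^m u_jf_j(y)$. Let $\overline{y}\in\mathbb{R}^d$ satisfy $f_0(\overline{y})=0$, let $\phi\in C^0(\mathbb{R}^d;[0,\infty))$, and let $y^0\in\mathbb{R}^d$. Assume that the system $\dot y=f(y,u)$ is controllable in some time $T_0>0$ with local cost estimate around $\overline{y}$ (Assumption (A) in the context). Then there exist a time $T^*>0$ and constants $C>0$ and $\mu>0$, all depending on $T_0,y^0,\overline{y}$ (and not on $T$), such that for every $T>T^*$, every global minimizer $u_T\in L^2(0,T;\mathbb{R}^m)$ of $$J_T(u)=\phi(y(T))+\int_0^T\|y(t)-\overline{y}\|^2\,\mathrm{d}t+\int_0^T\|u(t)\|^2\,\mathrm{d}t$$ (where $y$ solves $\dot y=f(y,u)$ in $(0,T)$, $y(0)=y^0$) and the corresponding state $y_T$, solution to $\dot y_T=f(y_T,u_T)$ with $y_T(0)=y^0$, satisfy $$\|y_T(t)-\overline{y}\|\leqslant C\left(e^{-\mu t}+e^{-\mu(T-t)}\right)\quad\text{for all }t\in[0,T],$$ and $$\|u_T\|_{L^2(0,T;\mathbb{R}^m)}\leqslant C.$$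
   Context: $\|\cdot\|$ is the Euclidean norm. For every $y^0\in\mathbb{R}^d$ and $u\in L^1(0,T;\mathbb{R}^m)$, the system $\dot y=f(y,u)$ on $(0,T)$ with $y(0)=y^0$ has a unique solution $y\in C^0([0,T];\mathbb{R}^d)$, understood through the integral formulation $y(t)=y^0+\int_0^tf(y(s),u(s))\,\mathrm{d}s$. Assumption (A) (controllability and cost estimate), for a time $T_0>0$ and the point $\overline{y}$: (i) for any $y^0,y^1\in\mathbb{R}^d$ there exists $u\in L^2(0,T_0;\mathbb{R}^m)$ such that the solution $y$ of $\dot y=f(y,u)$ on $(0,T_0)$ with $y(0)=y^0$ satisfies $y(T_0)=y^1$; (ii) there exist a radius $r>0$ and a constant $C(T_0)>0$ such that for all $y^0,y^1\in\{x\in\mathbb{R}^d:\|x-\overline{y}\|\leqslant r\}$, $$\inf\left\{\|u\|_{L^2(0,T_0;\mathbb{R}^m)}: y(0)=y^0,\ y(T_0)=\overline{y}\right\}\leqslant C(T_0)\|y^0-\overline{y}\|,$$ $$\inf\left\{\|u\|_{L^2(0,T_0;\mathbb{R}^m)}: y(0)=\overline{y},\ y(T_0)=y^1\right\}\leqslant C(T_0)\|y^1-\overline{y}\|,$$ where in each infimum $u$ ranges over controls in $L^2(0,T_0;\mathbb{R}^m)$ whose associated solution $y$ of $\dot y=f(y,u)$ has the indicated endpoint values. *)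

theory Defs
  imports "HOL-Analysis.Analysis"
begin

definition control_affine ::
  "(real^'d \<Rightarrow> real^'d) \<Rightarrow> ('m::finite \<Rightarrow> real^'d \<Rightarrow> real^'d) \<Rightarrow> real^'d \<Rightarrow> real^'m \<Rightarrow> real^'d" where
  "control_affine f0 fs y u = f0 y + (\<Sum>j\<in>UNIV. (u $ j) *\<^sub>R fs j y)"

text \<open>Elements of \<open>L\<^sup>2(0,T;\<real>\<^sup>m)\<close> are represented by total functions on the reals; only
  their values on the open interval matter, and these only up to null sets.\<close>

definition L2_control :: "real \<Rightarrow> (real \<Rightarrow> real^'m) \<Rightarrow> bool" where
  "L2_control T u \<longleftrightarrow>
     set_borel_measurable lebesgue {0<..<T} u \<and>
     set_integrable lebesgue {0<..<T} (\<lambda>t. (norm (u t))\<^sup>2)"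

definition L2_norm :: "real \<Rightarrow> (real \<Rightarrow> real^'m) \<Rightarrow> real" where
  "L2_norm T u = sqrt (LINT t:{0<..<T}|lebesgue. (norm (u t))\<^sup>2)"

text \<open>The integrability conjunct keeps the Bochner integral from defaulting to zero; for
  a control in \<open>L\<^sup>2\<close>, a right-hand side that is Lipschitz in the state and a continuous \<open>y\<close> it
  holds automatically. Values of \<open>y\<close> outside the interval from 0 to \<open>T\<close> are irrelevant.\<close>

definition solves ::
  "(real^'d \<Rightarrow> real^'m \<Rightarrow> real^'d) \<Rightarrow> real \<Rightarrow> real^'d \<Rightarrow> (real \<Rightarrow> real^'m) \<Rightarrow> (real \<Rightarrow> real^'d) \<Rightarrow> bool" where
  "solves f T y0 u y \<longleftrightarrow>
     continuous_on {0..T} y \<and>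
     (\<forall>t\<in>{0..T}. set_integrable lebesgue {0<..<t} (\<lambda>s. f (y s) (u s)) \<and>
        y t = y0 + (LINT s:{0<..<t}|lebesgue. f (y s) (u s)))"

definition steering_costs ::
  "(real^'d \<Rightarrow> real^'m \<Rightarrow> real^'d) \<Rightarrow> real \<Rightarrow> real^'d \<Rightarrow> real^'d \<Rightarrow> real set" where
  "steering_costs f T a b = {L2_norm T u | u y. L2_control T u \<and> solves f T a u y \<and> y T = b}"

text \<open>The infima are taken over sets that the first conjunct makes nonempty and that are
  bounded below by 0, so the infimum on the reals is the true one.\<close>

definition controllable_with_cost_estimate ::
  "(real^'d \<Rightarrow> real^'m \<Rightarrow> real^'d) \<Rightarrow> real \<Rightarrow> real^'d \<Rightarrow> bool" where
  "controllable_with_cost_estimate f T0 ybar \<longleftrightarrow>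
     (\<forall>y0 y1. \<exists>u y. L2_control T0 u \<and> solves f T0 y0 u y \<and> y T0 = y1) \<and>
     (\<exists>r>0. \<exists>K>0. \<forall>y0 y1. norm (y0 - ybar) \<le> r \<and> norm (y1 - ybar) \<le> r \<longrightarrow>
        Inf (steering_costs f T0 y0 ybar) \<le> K * norm (y0 - ybar) \<and>
        Inf (steering_costs f T0 ybar y1) \<le> K * norm (y1 - ybar))"

definition cost_functional ::
  "(real^'d \<Rightarrow> real) \<Rightarrow> real^'d \<Rightarrow> real \<Rightarrow> (real \<Rightarrow> real^'m) \<Rightarrow> (real \<Rightarrow> real^'d) \<Rightarrow> real" where
  "cost_functional \<phi> ybar T u y =
     \<phi> (y T) + (LINT t:{0<..<T}|lebesgue. (norm (y t - ybar))\<^sup>2)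
       + (LINT t:{0<..<T}|lebesgue. (norm (u t))\<^sup>2)"

text \<open>The state is determined on the time interval by the control, so minimizing over
  control-state pairs is minimizing over controls.\<close>

definition global_minimizer ::
  "(real^'d \<Rightarrow> real^'m \<Rightarrow> real^'d) \<Rightarrow> (real^'d \<Rightarrow> real) \<Rightarrow> real^'d \<Rightarrow> real^'d \<Rightarrow> real
     \<Rightarrow> (real \<Rightarrow> real^'m) \<Rightarrow> (real \<Rightarrow> real^'d) \<Rightarrow> bool" where
  "global_minimizer f \<phi> ybar y0 T u y \<longleftrightarrow>
     L2_control T u \<and> solves f T y0 u y \<and>
     (\<forall>v z. L2_control T v \<and> solves f T y0 v z \<longrightarrow>
        cost_functional \<phi> ybar T u y \<le> cost_functional \<phi> ybar T v z)"

end

theory Submission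
  imports Defs
begin

text \<open>Steering \<open>y0\<close> to \<open>ybar\<close> in time \<open>T0\<close> and resting there bounds the energy
  \<open>\<integral> \<parallel>y - ybar\<parallel>\<^sup>2 + \<parallel>u\<parallel>\<^sup>2\<close> of a minimizer independently of \<open>T\<close>. Between two times \<open>a\<close>, \<open>b\<close> at
  which the state is close to \<open>ybar\<close>, a minimizer can be compared with the trajectory that goes to
  \<open>ybar\<close>, rests and then goes to \<open>y b\<close>; so its energy on \<open>[a, b]\<close> is at most
  \<open>\<kappa> (\<parallel>y a - ybar\<parallel>\<^sup>2 + \<parallel>y b - ybar\<parallel>\<^sup>2)\<close>. Choosing \<open>a\<close> and \<open>b\<close> where the deviation is minimal
  in the two end pieces of length \<open>\<tau>\<close>, for \<open>\<tau>\<close> large, shows that cutting off these pieces halves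
  the energy. Energy therefore decays exponentially towards the middle of \<open>[0, T]\<close>, and a growth
  estimate over time \<open>\<tau>\<close> turns this into a pointwise bound.\<close>

subsection \<open>Trajectories and their energy\<close>

text \<open>On a bounded interval, \<open>L\<^sup>2\<close> controls are the absolutely integrable ones with integrable
  squared norm, which avoids a separate measurability condition.\<close>

definition trajectory ::
  "(real^'d \<Rightarrow> real^'m::finite \<Rightarrow> real^'d) \<Rightarrow> real \<Rightarrow> real \<Rightarrow> (real \<Rightarrow> real^'m) \<Rightarrow> (real \<Rightarrow> real^'d) \<Rightarrow> bool" where
  "trajectory f a b u y \<longleftrightarrow> a \<le> b \<and> continuous_on {a..b} y \<and>
     u absolutely_integrable_on {a..b} \<and> (\<lambda>t. (norm (u t))\<^sup>2) integrable_on {a..b} \<and>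
     (\<lambda>t. f (y t) (u t)) absolutely_integrable_on {a..b} \<and>
     (\<forall>t\<in>{a..b}. integral {a..t} (\<lambda>s. f (y s) (u s)) = y t - y a)"

definition energy ::
  "real^'d \<Rightarrow> real \<Rightarrow> real \<Rightarrow> (real \<Rightarrow> real^'m) \<Rightarrow> (real \<Rightarrow> real^'d) \<Rightarrow> real" where
  "energy ybar a b u y = integral {a..b} (\<lambda>t. (norm (y t - ybar))\<^sup>2 + (norm (u t))\<^sup>2)"

section \<open>Integrability, additivity and monotonicity of the energy\<close>

lemma trajectory_state_integrable:
  assumes "trajectory f a b u y"
  shows "(\<lambda>t. (norm (y t - ybar))\<^sup>2) integrable_on {a..b}"
  using assms by (auto simp: trajectory_def intro!: integrable_continuous_real continuous_intros)

lemma trajectory_energy_integrable: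
  assumes "trajectory f a b u y"
  shows "(\<lambda>t. (norm (y t - ybar))\<^sup>2 + (norm (u t))\<^sup>2) integrable_on {a..b}"
  using assms trajectory_state_integrable[OF assms]
  by (auto simp: trajectory_def intro!: integrable_add)

lemma energy_nonneg: "energy ybar a b u y \<ge> 0"
  \<comment> \<open>A non-integrable integrand has integral 0 by default, so the bound covers
    arbitrary \<open>u\<close> and \<open>y\<close>.\<close>
  unfolding energy_def by (cases "(\<lambda>t. (norm (y t - ybar))\<^sup>2 + (norm (u t))\<^sup>2) integrable_on {a..b}")
    (auto intro!: integral_nonneg simp: not_integrable_integral)

lemma energy_split:
  assumes "trajectory f a b u y"
  shows "energy ybar a b u y =
    integral {a..b} (\<lambda>t. (norm (y t - ybar))\<^sup>2) + integral {a..b} (\<lambda>t. (norm (u t))\<^sup>2)"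
  unfolding energy_def using assms trajectory_state_integrable[OF assms]
  by (auto simp: trajectory_def intro!: integral_add)

lemma control_le_energy:
  assumes "trajectory f a b u y"
  shows "integral {a..b} (\<lambda>t. (norm (u t))\<^sup>2) \<le> energy ybar a b u y"
  unfolding energy_def using assms trajectory_energy_integrable[OF assms]
  by (auto simp: trajectory_def intro!: integral_le)

lemma energy_combine:
  assumes "trajectory f a c u y" "a \<le> b" "b \<le> c"
  shows "energy ybar a c u y = energy ybar a b u y + energy ybar b c u y"
  unfolding energy_def
  using Henstock_Kurzweil_Integration.integral_combine[OF assms(2,3) trajectory_energy_integrable[OF assms(1)]]
  by simp

lemma energy_mono:
  assumes "trajectory f a b u y" "a \<le> c" "c \<le> d" "d \<le> b"
  shows "energy ybar c d u y \<le> energy ybar a b u y"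
  unfolding energy_def
  by (intro integral_subset_le integrable_subinterval_real[OF trajectory_energy_integrable[OF assms(1)]]
        trajectory_energy_integrable[OF assms(1)]) (use assms in auto)

section \<open>Gluing, cutting and translating trajectories\<close>

lemma trajectory_spike:
  assumes tr: "trajectory f a b u y"
    and z: "\<And>t. t \<in> {a..b} \<Longrightarrow> z t = y t" and v: "\<And>t. t \<in> {a<..<b} \<Longrightarrow> v t = u t"
  shows "trajectory f a b v z" "energy ybar a b v z = energy ybar a b u y"
proof -
  \<comment> \<open>The control may differ at the two end points, a null set. This is what lets two
    controls be glued although they disagree at the junction; the state has to agree there.\<close>
  have neg: "negligible {a, b}" by simp
  note T = tr[unfolded trajectory_def]
  have 1: "continuous_on {a..b} z"
    using continuous_on_cong[of "{a..b}" "{a..b}" z y] T z by blast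
  have 2: "v absolutely_integrable_on {a..b}"
    by (rule absolutely_integrable_spike[where f = u, OF _ neg]) (use T v in auto)
  have 3: "(\<lambda>t. (norm (v t))\<^sup>2) integrable_on {a..b}"
    by (rule integrable_spike[where f = "\<lambda>t. (norm (u t))\<^sup>2", OF _ neg]) (use T v in auto)
  have 4: "(\<lambda>t. f (z t) (v t)) absolutely_integrable_on {a..b}"
    by (rule absolutely_integrable_spike[where f = "\<lambda>t. f (y t) (u t)", OF _ neg]) (use T v z in auto)
  have 5: "integral {a..t} (\<lambda>s. f (z s) (v s)) = integral {a..t} (\<lambda>s. f (y s) (u s))" if "t \<in> {a..b}" for t
    by (rule integral_spike[OF neg]) (use that v z in auto)
  show "trajectory f a b v z"
    using T 1 2 3 4 5 z by (auto simp: trajectory_def)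
  show "energy ybar a b v z = energy ybar a b u y"
    unfolding energy_def by (rule integral_spike[OF neg]) (use v z in auto)
qed

lemma trajectory_join:
  assumes 1: "trajectory f a b u y" and 2: "trajectory f b c u y"
  shows "trajectory f a c u y"
proof -
  have *: "{a..b} \<union> {b..c} = {a..c}" "a \<le> b" "b \<le> c" using assms by (auto simp: trajectory_def)
  have cont: "continuous_on {a..c} y"
    using continuous_on_closed_Un[of "{a..b}" "{b..c}" y] assms * by (auto simp: trajectory_def)
  have u2: "(\<lambda>t. (norm (u t))\<^sup>2) integrable_on {a..c}"
    by (rule Henstock_Kurzweil_Integration.integrable_combine[OF *(2,3)]) (use assms in \<open>auto simp: trajectory_def\<close>)
  have u1: "u absolutely_integrable_on {a..c}"
    by (rule absolutely_integrable_on_combine[where c = b]) (use assms in \<open>auto simp: trajectory_def\<close>)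
  have f: "(\<lambda>t. f (y t) (u t)) absolutely_integrable_on {a..c}"
    by (rule absolutely_integrable_on_combine[where c = b]) (use assms in \<open>auto simp: trajectory_def\<close>)
  have "integral {a..t} (\<lambda>s. f (y s) (u s)) = y t - y a" if t: "t \<in> {a..c}" for t
  proof (cases "t \<le> b")
    case True then show ?thesis using 1 t by (auto simp: trajectory_def)
  next
    case False
    have int: "(\<lambda>t. f (y t) (u t)) integrable_on {a..t}"
      by (rule integrable_subinterval_real[of _ a c])
         (use f t in \<open>auto simp: absolutely_integrable_on_def\<close>)
    then have "integral {a..t} (\<lambda>s. f (y s) (u s)) =
        integral {a..b} (\<lambda>s. f (y s) (u s)) + integral {b..t} (\<lambda>s. f (y s) (u s))"
      using Henstock_Kurzweil_Integration.integral_combine[OF _ _ int, of b] False * by simp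
    moreover have "integral {a..b} (\<lambda>s. f (y s) (u s)) = y b - y a"
      using 1 by (auto simp: trajectory_def)
    moreover have "integral {b..t} (\<lambda>s. f (y s) (u s)) = y t - y b"
      using 2 False t by (auto simp: trajectory_def)
    ultimately show ?thesis by simp
  qed
  then show ?thesis using cont u1 u2 f * by (auto simp: trajectory_def)
qed

lemma trajectory_subinterval:
  assumes tr: "trajectory f a b u y" and "a \<le> c" "c \<le> d" "d \<le> b"
  shows "trajectory f c d u y"
proof -
  note T = tr[unfolded trajectory_def]
  have sub: "{c..d} \<subseteq> {a..b}" using assms by auto
  have "integral {c..t} (\<lambda>s. f (y s) (u s)) = y t - y c" if t: "t \<in> {c..d}" for t
  proof -
    have int: "(\<lambda>t. f (y t) (u t)) integrable_on {a..t}"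
      by (rule integrable_subinterval_real[of _ a b])
         (use T assms t in \<open>auto simp: absolutely_integrable_on_def\<close>)
    then have "integral {a..t} (\<lambda>s. f (y s) (u s)) =
        integral {a..c} (\<lambda>s. f (y s) (u s)) + integral {c..t} (\<lambda>s. f (y s) (u s))"
      using Henstock_Kurzweil_Integration.integral_combine[OF _ _ int, of c] assms t by simp
    moreover have "integral {a..c} (\<lambda>s. f (y s) (u s)) = y c - y a"
      "integral {a..t} (\<lambda>s. f (y s) (u s)) = y t - y a"
      using T t assms by auto
    ultimately show ?thesis by simp
  qed
  moreover have "continuous_on {c..d} y"
    using T sub continuous_on_subset by blast
  moreover have "u absolutely_integrable_on {c..d}" "(\<lambda>t. f (y t) (u t)) absolutely_integrable_on {c..d}"
    using T sub absolutely_integrable_on_subinterval by blast+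
  moreover have "(\<lambda>t. (norm (u t))\<^sup>2) integrable_on {c..d}"
    using T sub integrable_subinterval_real by blast
  ultimately show ?thesis
    unfolding trajectory_def using assms by blast
qed

text \<open>Each half of the piecewise control agrees with its original on the open subinterval, so
  \<open>trajectory_spike\<close> applies to both halves. Later arguments use only end states and
  energy, hence the existential form.\<close>

lemma trajectory_concat:
  assumes 1: "trajectory f a b u y" and 2: "trajectory f b c v z" and "y b = z b"
  shows "\<exists>w x. trajectory f a c w x \<and> x a = y a \<and> x c = z c \<and>
    energy ybar a c w x = energy ybar a b u y + energy ybar b c v z"
proof -
  define w where "w = (\<lambda>t. if t \<le> b then u t else v t)"
  define x where "x = (\<lambda>t. if t \<le> b then y t else z t)"
  have ab: "a \<le> b" "b \<le> c" using assms by (auto simp: trajectory_def)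
  have l: "trajectory f a b w x" "energy ybar a b w x = energy ybar a b u y"
    by (rule trajectory_spike[OF 1]; simp add: w_def x_def)+
  have r: "trajectory f b c w x" "energy ybar b c w x = energy ybar b c v z"
    by (rule trajectory_spike[OF 2]; use assms(3) in \<open>auto simp: w_def x_def\<close>)+
  have "trajectory f a c w x" using trajectory_join l r by blast
  moreover from energy_combine[OF this ab] have "energy ybar a c w x = energy ybar a b u y + energy ybar b c v z"
    using l r by simp
  moreover have "x a = y a" "x c = z c"
    using ab assms(3) by (auto simp: x_def)
  ultimately show ?thesis by blast
qed

lemma absolutely_integrable_shift_Icc:
  fixes g :: "real \<Rightarrow> 'a::euclidean_space"
  assumes "g absolutely_integrable_on {a..b}"
  shows "(\<lambda>t. g (t - c)) absolutely_integrable_on {a+c..b+c}"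
  using assms integrable_shift_real_ivl[of g a b "-c"] integrable_shift_real_ivl[of "\<lambda>t. norm (g t)" a b "-c"]
  unfolding absolutely_integrable_on_def by simp

lemma trajectory_shift:
  assumes tr: "trajectory f a b u y"
  shows "trajectory f (a + c) (b + c) (\<lambda>t. u (t - c)) (\<lambda>t. y (t - c))"
    "energy ybar (a + c) (b + c) (\<lambda>t. u (t - c)) (\<lambda>t. y (t - c)) = energy ybar a b u y"
proof -
  have ab: "a \<le> b" and cont: "continuous_on {a..b} y"
    and ai: "u absolutely_integrable_on {a..b}" "(\<lambda>t. f (y t) (u t)) absolutely_integrable_on {a..b}"
    and u2: "(\<lambda>t. (norm (u t))\<^sup>2) integrable_on {a..b}"
    and int: "\<And>t. t \<in> {a..b} \<Longrightarrow> integral {a..t} (\<lambda>s. f (y s) (u s)) = y t - y a"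
    using tr unfolding trajectory_def by blast+
  have shift: "integral {a+c..t+c} (\<lambda>s. g (s - c)) = integral {a..t} g" for g :: "real \<Rightarrow> 'e::real_normed_vector" and t
    using integral_shift_real_ivl[of a "-c" t g] by (simp only: diff_minus_eq_add add_uminus_conv_diff)
  have "integral {a+c..t} (\<lambda>s. f (y (s - c)) (u (s - c))) = y (t - c) - y a" if "t \<in> {a+c..b+c}" for t
    using int[of "t - c"] that shift[of "t - c" "\<lambda>s. f (y s) (u s)"] by simp
  moreover have "continuous_on {a+c..b+c} (\<lambda>t. y (t - c))"
    by (rule continuous_on_compose2[OF cont]) (auto intro!: continuous_intros)
  moreover have "(\<lambda>t. (norm (u (t - c)))\<^sup>2) integrable_on {a+c..b+c}"
    using integrable_shift_real_ivl[of "\<lambda>t. (norm (u t))\<^sup>2" a b "-c"] u2 by simp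
  ultimately show "trajectory f (a + c) (b + c) (\<lambda>t. u (t - c)) (\<lambda>t. y (t - c))"
    unfolding trajectory_def using ab ai[THEN absolutely_integrable_shift_Icc, of c] by auto
  show "energy ybar (a + c) (b + c) (\<lambda>t. u (t - c)) (\<lambda>t. y (t - c)) = energy ybar a b u y"
    unfolding energy_def by (rule shift)
qed

lemma trajectory_rest:
  fixes f :: "real^'d \<Rightarrow> real^'m::finite \<Rightarrow> real^'d"
  assumes "f ybar 0 = 0" "a \<le> b"
  shows "trajectory f a b (\<lambda>_. 0) (\<lambda>_. ybar)" "energy ybar a b (\<lambda>_. 0 :: real^'m) (\<lambda>_. ybar) = 0"
  using assms by (auto simp: trajectory_def energy_def)

section \<open>Passage between trajectories and the Lebesgue integrals of the definitions\<close>

lemma L2_norm_eq: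
  assumes "trajectory f 0 T u y"
  shows "L2_norm T u = sqrt (integral {0..T} (\<lambda>t. (norm (u t))\<^sup>2))"
proof -
  have "(\<lambda>t. (norm (u t))\<^sup>2) absolutely_integrable_on {0<..<T}"
    using assms unfolding absolutely_integrable_on_Icc_iff_Ioo[symmetric]
    by (intro nonnegative_absolutely_integrable_1) (auto simp: trajectory_def)
  then show ?thesis
    by (simp add: L2_norm_def set_lebesgue_integral_eq_integral integral_open_interval_real)
qed

lemma cost_functional_eq:
  assumes tr: "trajectory f 0 T u y"
  shows "cost_functional \<phi> ybar T u y = \<phi> (y T) + energy ybar 0 T u y"
proof -
  have "(\<lambda>t. (norm (u t))\<^sup>2) absolutely_integrable_on {0<..<T}"
    "(\<lambda>t. (norm (y t - ybar))\<^sup>2) absolutely_integrable_on {0<..<T}"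
    using tr trajectory_state_integrable[OF tr]
    unfolding absolutely_integrable_on_Icc_iff_Ioo[symmetric]
    by (auto intro!: nonnegative_absolutely_integrable_1 simp: trajectory_def)
  then show ?thesis
    by (simp add: energy_split[OF tr] cost_functional_def set_lebesgue_integral_eq_integral integral_open_interval_real)
qed

lemma trajectory_iff:
  assumes "T \<ge> 0"
  shows "L2_control T u \<and> solves f T a u y \<longleftrightarrow> trajectory f 0 T u y \<and> y 0 = a"
proof
  assume lr: "L2_control T u \<and> solves f T a u y"
  have y: "integral {0..t} (\<lambda>s. f (y s) (u s)) = y t - a" if "t \<in> {0..T}" for t
  proof -
    have "set_integrable lebesgue {0<..<t} (\<lambda>s. f (y s) (u s))"
      "y t = a + (LINT s:{0<..<t}|lebesgue. f (y s) (u s))"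
      using lr that by (auto simp: solves_def)
    then show ?thesis
      by (simp add: set_lebesgue_integral_eq_integral integral_open_interval_real)
  qed
  \<comment> \<open>The integral equation at time 0 recovers the initial value.\<close>
  have y0: "y 0 = a" using y[of 0] assms by simp
  have cont: "continuous_on {0..T} y" and fint: "(\<lambda>s. f (y s) (u s)) absolutely_integrable_on {0..T}"
    using lr assms by (auto simp: solves_def absolutely_integrable_on_Icc_iff_Ioo)
  have u2: "(\<lambda>t. (norm (u t))\<^sup>2) integrable_on {0<..<T}"
    using lr by (auto simp: L2_control_def absolutely_integrable_on_def)
  \<comment> \<open>The embedding of \<open>L\<^sup>2\<close> into \<open>L\<^sup>1\<close> on a
    bounded interval: the norm of \<open>u t\<close> is dominated by 1 plus its square.\<close>
  have "(\<lambda>t. 1 + (norm (u t))\<^sup>2) integrable_on {0<..<T}"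
    by (intro integrable_add u2) (auto simp: integrable_on_const)
  moreover have "u \<in> borel_measurable (lebesgue_on {0<..<T})"
    using lr by (auto simp: L2_control_def set_borel_measurable_def borel_measurable_restrict_space_iff)
  moreover have "norm (u t) \<le> 1 + (norm (u t))\<^sup>2" for t
    using sum_squares_bound[of 1 "norm (u t)"] norm_ge_zero[of "u t"] unfolding one_power2 by linarith
  ultimately have "u absolutely_integrable_on {0<..<T}"
    by (intro measurable_bounded_by_integrable_imp_absolutely_integrable) auto
  then show "trajectory f 0 T u y \<and> y 0 = a"
    using u2 assms y y0 cont fint
    by (auto simp: trajectory_def absolutely_integrable_on_Icc_iff_Ioo integrable_on_open_interval_real)
next
  assume lr: "trajectory f 0 T u y \<and> y 0 = a"
  then have "u absolutely_integrable_on {0<..<T}"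
    by (auto simp: absolutely_integrable_on_Icc_iff_Ioo[symmetric] trajectory_def)
  then have "set_borel_measurable lebesgue {0<..<T} u"
    unfolding set_borel_measurable_def set_integrable_def by auto
  moreover have "set_integrable lebesgue {0<..<T} (\<lambda>t. (norm (u t))\<^sup>2)"
    using lr unfolding absolutely_integrable_on_Icc_iff_Ioo[symmetric]
    by (intro nonnegative_absolutely_integrable_1) (auto simp: trajectory_def)
  moreover have "set_integrable lebesgue {0<..<t} (\<lambda>s. f (y s) (u s))" if "t \<in> {0..T}" for t
    unfolding absolutely_integrable_on_Icc_iff_Ioo[symmetric]
    by (rule absolutely_integrable_on_subinterval[where S = "{0..T}"]) (use lr that in \<open>auto simp: trajectory_def\<close>)
  ultimately show "L2_control T u \<and> solves f T a u y"
    using lr by (auto simp: L2_control_def solves_def set_lebesgue_integral_eq_integral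
        integral_open_interval_real trajectory_def)
qed

subsection \<open>Growth and steering\<close>

text \<open>Cauchy-Schwarz against the constant 1. With \<open>l\<close> the length of the interval
  and \<open>I\<close> the integral of \<open>g\<close>, integrating the nonnegative function
  \<open>(l * g t - I)\<^sup>2\<close> gives \<open>l\<close> times the difference of the two
  sides.\<close>

lemma integral_power2_le:
  fixes g :: "real \<Rightarrow> real"
  assumes "a \<le> b" and g: "g integrable_on {a..b}" and g2: "(\<lambda>t. (g t)\<^sup>2) integrable_on {a..b}"
  shows "(integral {a..b} g)\<^sup>2 \<le> (b - a) * integral {a..b} (\<lambda>t. (g t)\<^sup>2)"
proof (cases "a = b")
  case False
  define l I where "l = b - a" and "I = integral {a..b} g"
  have l: "l > 0" using False assms by (simp add: l_def)
  have eq: "(l * g t - I)\<^sup>2 = l\<^sup>2 * (g t)\<^sup>2 - (2 * l * I) * g t + I\<^sup>2" for t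
    by (simp add: power2_eq_square algebra_simps)
  have "((\<lambda>t. l\<^sup>2 * (g t)\<^sup>2 - (2 * l * I) * g t + I\<^sup>2) has_integral
      (l\<^sup>2 * integral {a..b} (\<lambda>t. (g t)\<^sup>2) - (2 * l * I) * I + l * I\<^sup>2)) {a..b}"
    using has_integral_const_real[of "I\<^sup>2" a b] \<open>a \<le> b\<close> unfolding I_def
    by (intro has_integral_add has_integral_diff has_integral_mult_right integrable_integral g g2)
       (auto simp: l_def)
  then have "0 \<le> l\<^sup>2 * integral {a..b} (\<lambda>t. (g t)\<^sup>2) - (2 * l * I) * I + l * I\<^sup>2"
    by (rule has_integral_nonneg) (simp flip: eq)
  also have "\<dots> = l * (l * integral {a..b} (\<lambda>t. (g t)\<^sup>2) - I\<^sup>2)"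
    by (simp add: power2_eq_square algebra_simps)
  finally show ?thesis
    using l by (simp add: zero_le_mult_iff l_def I_def)
qed simp

text \<open>The infimum need not be attained, so the bound \<open>c\<close> lies strictly above it;
  controllability makes the set of costs nonempty, so some cost falls below
  \<open>c\<close>.\<close>

lemma exists_near_optimal_steering:
  assumes "T \<ge> 0" and ex: "\<And>a b. \<exists>u y. L2_control T u \<and> solves f T a u y \<and> y T = b"
    and "Inf (steering_costs f T a b) < c"
  obtains u y where "trajectory f 0 T u y" "y 0 = a" "y T = b"
    "integral {0..T} (\<lambda>t. (norm (u t))\<^sup>2) \<le> c\<^sup>2"
proof -
  have "steering_costs f T a b \<noteq> {}"
    using ex[of a b] by (auto simp: steering_costs_def)
  from cInf_lessD[OF this assms(3)] obtain u y where
    *: "L2_control T u \<and> solves f T a u y" "y T = b" "L2_norm T u < c"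
    by (auto simp: steering_costs_def)
  then have tr: "trajectory f 0 T u y" "y 0 = a" using trajectory_iff[OF assms(1)] by blast+
  have "sqrt (integral {0..T} (\<lambda>t. (norm (u t))\<^sup>2)) \<le> c"
    using * L2_norm_eq[OF tr(1)] by simp
  then have "integral {0..T} (\<lambda>t. (norm (u t))\<^sup>2) \<le> c\<^sup>2"
    by (rule sqrt_le_D)
  then show ?thesis using that tr * by blast
qed

text \<open>The form of the dynamics enters the turnpike argument only through this bound. The
  factor \<open>1 + norm (y - ybar)\<close> next to the control reflects that control fields need
  not vanish at \<open>ybar\<close>.\<close>

locale controlled_growth =
  fixes f :: "real^'d \<Rightarrow> real^'m::finite \<Rightarrow> real^'d" and ybar :: "real^'d" and M :: real
  assumes M: "M > 0"
    and growth: "\<And>y u. norm (f y u) \<le> M * (norm (y - ybar) + norm u * (1 + norm (y - ybar)))"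
begin

lemma equilibrium: "f ybar 0 = 0"
  using growth[of ybar 0] by simp

text \<open>On a short interval the maximum of the deviation can be absorbed into the left-hand side of
  the integral inequality; iterating this over finitely many intervals replaces Gronwall's lemma.\<close>

lemma short_time_bound:
  assumes tr: "trajectory f a b u y"
    and small: "M * ((b - a) + integral {a..b} (\<lambda>t. norm (u t))) \<le> 1/2"
  shows "norm (y b - ybar) \<le> 2 * norm (y a - ybar) + 2 * M * integral {a..b} (\<lambda>t. norm (u t))"
proof -
  define I where "I = integral {a..b} (\<lambda>t. norm (u t))"
  have ab: "a \<le> b" and cont: "continuous_on {a..b} y"
    and fint: "(\<lambda>t. f (y t) (u t)) absolutely_integrable_on {a..b}"
    and uint: "(\<lambda>t. norm (u t)) integrable_on {a..b}"
    and int: "\<And>t. t \<in> {a..b} \<Longrightarrow> integral {a..t} (\<lambda>s. f (y s) (u s)) = y t - y a"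
    using tr unfolding trajectory_def absolutely_integrable_on_def by blast+
  obtain p where p: "p \<in> {a..b}" and max: "\<And>t. t \<in> {a..b} \<Longrightarrow> norm (y t - ybar) \<le> norm (y p - ybar)"
    using continuous_attains_sup[OF compact_Icc, of a b "\<lambda>t. norm (y t - ybar)"] ab cont
      continuous_on_norm[OF continuous_on_diff[OF cont continuous_on_const]] by fastforce
  define m where "m = norm (y p - ybar)"
  have m0: "m \<ge> 0" by (simp add: m_def)
  have I0: "I \<ge> 0" unfolding I_def by (intro integral_nonneg uint) auto
  have sub: "{a..p} \<subseteq> {a..b}" using p by auto
  have gint: "(\<lambda>t. M * m + M * (1 + m) * norm (u t)) integrable_on {a..b}"
    by (intro integrable_add integrable_on_mult_right uint) auto
  have "norm (y p - y a) = norm (integral {a..p} (\<lambda>s. f (y s) (u s)))"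
    using int[OF p] by simp
  also have "\<dots> \<le> integral {a..p} (\<lambda>t. M * m + M * (1 + m) * norm (u t))"
  proof (rule integral_norm_bound_integral)
    show "(\<lambda>s. f (y s) (u s)) integrable_on {a..p}"
      using fint sub unfolding absolutely_integrable_on_def by (blast intro: integrable_subinterval_real)
    show "(\<lambda>t. M * m + M * (1 + m) * norm (u t)) integrable_on {a..p}"
      using gint sub by (rule integrable_subinterval_real)
    fix t assume t: "t \<in> {a..p}"
    then have le: "norm (y t - ybar) \<le> m" using max[of t] sub by (auto simp: m_def)
    have "norm (f (y t) (u t)) \<le> M * (norm (y t - ybar) + norm (u t) * (1 + norm (y t - ybar)))"
      by (rule growth)
    also have "\<dots> \<le> M * (m + norm (u t) * (1 + m))"
      using M le by (intro mult_left_mono add_mono) auto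
    finally show "norm (f (y t) (u t)) \<le> M * m + M * (1 + m) * norm (u t)"
      by (simp add: algebra_simps)
  qed
  also have "\<dots> \<le> integral {a..b} (\<lambda>t. M * m + M * (1 + m) * norm (u t))"
    using M m0 by (intro integral_subset_le sub gint integrable_subinterval_real[OF gint]) auto
  also have "\<dots> = M * m * (b - a) + M * (1 + m) * I"
    unfolding I_def using ab by (subst integral_add) (auto intro!: integrable_on_mult_right uint)
  also have "\<dots> = m * (M * ((b - a) + I)) + M * I" by (simp add: algebra_simps)
  also have "\<dots> \<le> m * (1/2) + M * I"
    using small m0 by (intro add_right_mono mult_left_mono) (auto simp: I_def)
  finally have "norm (y p - y a) \<le> m / 2 + M * I" by simp
  moreover have "m \<le> norm (y a - ybar) + norm (y p - y a)"
    unfolding m_def using norm_triangle_ineq[of "y a - ybar" "y p - y a"] by simp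
  ultimately have "m \<le> 2 * norm (y a - ybar) + 2 * M * I" by simp
  then show ?thesis using max[of b] ab by (simp add: m_def I_def)
qed

text \<open>An interval of length at most \<open>L\<close> is cut into a fixed number of short
  pieces, so \<open>G\<close> is uniform over all trajectories with \<open>q \<le> R\<close>.
  Linearity in the initial deviation and \<open>q\<close> is essential: it keeps steering energies
  quadratic and transfers the decay of \<open>q\<close> to the state.\<close>

lemma bounded_time_bound:
  obtains G where "G \<ge> 1"
    and "\<And>a b u y q. trajectory f a b u y \<Longrightarrow> b - a \<le> L \<Longrightarrow> 0 \<le> q \<Longrightarrow> q \<le> R \<Longrightarrow>
      integral {a..b} (\<lambda>t. (norm (u t))\<^sup>2) \<le> q\<^sup>2 \<Longrightarrow> norm (y b - ybar) \<le> G * (norm (y a - ybar) + q)"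
proof -
  \<comment> \<open>On a piece of length at most \<open>s\<^sup>2\<close>, Cauchy-Schwarz bounds the
    integral of \<open>norm (u t)\<close> by \<open>s * q\<close>. As \<open>s \<le> 1\<close>,
    length plus integral is at most \<open>s * (1 + \<bar>R\<bar>)\<close>, and this
    \<open>s\<close> meets the smallness condition of \<open>short_time_bound\<close>.\<close>
  define s where "s = min 1 (1 / (2 * M * (1 + \<bar>R\<bar>)))"
  have s: "0 < s" "s \<le> 1" "s \<le> 1 / (2 * M * (1 + \<bar>R\<bar>))" using M by (auto simp: s_def)
  have sM: "M * (s * (1 + \<bar>R\<bar>)) \<le> 1/2"
    using s(3) M by (simp add: field_simps pos_le_divide_eq add_pos_nonneg)
  \<comment> \<open>The right-hand side solves the recursion in which each piece doubles the
    deviation and adds \<open>2 * M * q\<close>.\<close>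
  have step: "norm (y b - ybar) \<le> 2 ^ n * norm (y a - ybar) + (2 ^ n - 1) * (2 * M * q)"
    if "trajectory f a b u y" "b - a \<le> n * s\<^sup>2" "0 \<le> q" "q \<le> R"
      "integral {a..b} (\<lambda>t. (norm (u t))\<^sup>2) \<le> q\<^sup>2" for n :: nat and a b u y q
    using that
  proof (induction n arbitrary: b)
    case 0
    then have "a = b" by (auto simp: trajectory_def)
    then show ?case by simp
  next
    case (Suc n)
    \<comment> \<open>The last piece is \<open>{c..b}\<close>; the maximum covers intervals shorter
      than \<open>s\<^sup>2\<close>.\<close>
    define c where "c = max a (b - s\<^sup>2)"
    have ab: "a \<le> b" using Suc.prems by (auto simp: trajectory_def)
    have c: "a \<le> c" "c \<le> b" "b - c \<le> s\<^sup>2" "c - a \<le> n * s\<^sup>2"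
      using ab Suc.prems(2) by (auto simp: c_def algebra_simps)
    note tr1 = trajectory_subinterval[OF Suc.prems(1) order.refl c(1,2)]
    note tr2 = trajectory_subinterval[OF Suc.prems(1) c(1,2) order.refl]
    have u2: "(\<lambda>t. (norm (u t))\<^sup>2) integrable_on {a..b}"
      using Suc.prems(1) by (simp add: trajectory_def)
    have q: "integral {a'..b'} (\<lambda>t. (norm (u t))\<^sup>2) \<le> q\<^sup>2" if "a \<le> a'" "b' \<le> b" for a' b'
    proof -
      have "integral {a'..b'} (\<lambda>t. (norm (u t))\<^sup>2) \<le> integral {a..b} (\<lambda>t. (norm (u t))\<^sup>2)"
        using that by (intro integral_subset_le u2 integrable_subinterval_real[OF u2]) auto
      then show ?thesis using Suc.prems by simp
    qed
    define I where "I = integral {c..b} (\<lambda>t. norm (u t))"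
    have "I\<^sup>2 \<le> (b - c) * integral {c..b} (\<lambda>t. (norm (u t))\<^sup>2)"
      unfolding I_def using tr2
      by (intro integral_power2_le) (auto simp: trajectory_def absolutely_integrable_on_def)
    also have "\<dots> \<le> s\<^sup>2 * q\<^sup>2"
      using c q[of c b] tr2 by (intro mult_mono integral_nonneg) (auto simp: trajectory_def)
    finally have I: "I \<le> s * q"
      using s Suc.prems by (intro power2_le_imp_le[of I "s * q"]) (auto simp: power_mult_distrib)
    also have "\<dots> \<le> q" using s Suc.prems mult_left_le_one_le[of q s] by simp
    finally have Iq: "I \<le> q" .
    have "s\<^sup>2 \<le> s" using s by (simp add: power2_eq_square mult_left_le)
    moreover have "s * q \<le> s * \<bar>R\<bar>" using s Suc.prems by (intro mult_left_mono) auto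
    ultimately have "(b - c) + I \<le> s * (1 + \<bar>R\<bar>)"
      using c I by (simp add: algebra_simps)
    then have "M * ((b - c) + I) \<le> M * (s * (1 + \<bar>R\<bar>))" using M by simp
    then have "norm (y b - ybar) \<le> 2 * norm (y c - ybar) + 2 * M * I"
      using short_time_bound[OF tr2] sM unfolding I_def by linarith
    also have "\<dots> \<le> 2 * (2 ^ n * norm (y a - ybar) + (2 ^ n - 1) * (2 * M * q)) + 2 * M * q"
      using Suc.IH[OF tr1 c(4) Suc.prems(3,4) q[of a c]] c M Iq
      by (intro add_mono mult_left_mono) auto
    also have "\<dots> = 2 ^ Suc n * norm (y a - ybar) + (2 ^ Suc n - 1) * (2 * M * q)"
      by (simp add: algebra_simps)
    finally show ?case .
  qed
  obtain n :: nat where n: "L / s\<^sup>2 \<le> n" using real_arch_simple by blast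
  then have n: "L \<le> n * s\<^sup>2" using s by (simp add: field_simps)
  show ?thesis
  proof
    show "1 \<le> 2 ^ n * (1 + 2 * M)"
      using M mult_mono[of 1 "2^n" 1 "1 + 2 * M"] by simp
    fix a b u y q
    assume *: "trajectory f a b u y" "b - a \<le> L" "0 \<le> q" "q \<le> R"
      "integral {a..b} (\<lambda>t. (norm (u t))\<^sup>2) \<le> q\<^sup>2"
    have "norm (y b - ybar) \<le> 2 ^ n * norm (y a - ybar) + (2 ^ n - 1) * (2 * M * q)"
      by (rule step[OF *(1) _ *(3-5)]) (use * n in simp)
    also have "\<dots> \<le> 2 ^ n * (1 + 2 * M) * norm (y a - ybar) + 2 ^ n * (1 + 2 * M) * q"
    proof (rule add_mono)
      show "2 ^ n * norm (y a - ybar) \<le> 2 ^ n * (1 + 2 * M) * norm (y a - ybar)"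
        using M by (intro mult_right_mono) auto
      have "(2 ^ n - 1) * (2 * M) \<le> 2 ^ n * (1 + 2 * M)"
        using M by (intro mult_mono) auto
      then show "(2 ^ n - 1) * (2 * M * q) \<le> 2 ^ n * (1 + 2 * M) * q"
        using mult_right_mono[OF _ *(3), of "(2 ^ n - 1) * (2 * M)" "2 ^ n * (1 + 2 * M)"]
        by (simp add: mult.assoc)
    qed
    finally show "norm (y b - ybar) \<le> 2 ^ n * (1 + 2 * M) * (norm (y a - ybar) + q)"
      by (simp add: algebra_simps)
  qed
qed

text \<open>The assumption bounds the control alone. \<open>bounded_time_bound\<close> then bounds
  the state linearly in the distance to \<open>ybar\<close>, so the whole energy is quadratic in
  that distance.\<close>

lemma exists_cheap_steering:
  assumes T: "T > 0" and contr: "controllable_with_cost_estimate f T ybar"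
  obtains r \<kappa> where "r > 0" "\<kappa> > 0"
    and "\<And>x. norm (x - ybar) \<le> r \<Longrightarrow> \<exists>u y. trajectory f 0 T u y \<and> y 0 = x \<and> y T = ybar \<and>
      energy ybar 0 T u y \<le> \<kappa> * (norm (x - ybar))\<^sup>2"
    and "\<And>x. norm (x - ybar) \<le> r \<Longrightarrow> \<exists>u y. trajectory f 0 T u y \<and> y 0 = ybar \<and> y T = x \<and>
      energy ybar 0 T u y \<le> \<kappa> * (norm (x - ybar))\<^sup>2"
proof -
  have ex: "\<And>a b. \<exists>u y. L2_control T u \<and> solves f T a u y \<and> y T = b"
    using contr unfolding controllable_with_cost_estimate_def by blast
  obtain r K where r: "r > 0" and K: "K > 0"
    and to: "\<And>x. norm (x - ybar) \<le> r \<Longrightarrow> Inf (steering_costs f T x ybar) \<le> K * norm (x - ybar)"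
    and fro: "\<And>x. norm (x - ybar) \<le> r \<Longrightarrow> Inf (steering_costs f T ybar x) \<le> K * norm (x - ybar)"
    using contr unfolding controllable_with_cost_estimate_def by metis
  obtain G where G: "G \<ge> 1"
    and bound: "\<And>a b u y q. trajectory f a b u y \<Longrightarrow> b - a \<le> T \<Longrightarrow> 0 \<le> q \<Longrightarrow> q \<le> 2 * K * r \<Longrightarrow>
      integral {a..b} (\<lambda>t. (norm (u t))\<^sup>2) \<le> q\<^sup>2 \<Longrightarrow> norm (y b - ybar) \<le> G * (norm (y a - ybar) + q)"
    using bounded_time_bound[of T "2 * K * r"] by blast
  \<comment> \<open>The first summand comes from the pointwise deviation bound
    \<open>G * (1 + 2 * K) * \<rho>\<close> over time \<open>T\<close>, the second from a control of
    norm at most \<open>2 * K * \<rho>\<close>; doubling \<open>K\<close> leaves room above the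
    infimum.\<close>
  define \<kappa> where "\<kappa> = T * (G * (1 + 2 * K))\<^sup>2 + (2 * K)\<^sup>2"
  have \<kappa>: "\<kappa> > 0" using T K by (simp add: \<kappa>_def add_nonneg_pos)
  \<comment> \<open>One estimate serves both directions: the start is at distance
    \<open>\<rho>\<close> when steering to \<open>ybar\<close> and at distance 0 when steering away
    from it.\<close>
  have est: "energy ybar 0 T u y \<le> \<kappa> * \<rho>\<^sup>2"
    if tr: "trajectory f 0 T u y" and y0: "norm (y 0 - ybar) \<le> \<rho>" and \<rho>: "0 \<le> \<rho>" "\<rho> \<le> r"
      and u: "integral {0..T} (\<lambda>t. (norm (u t))\<^sup>2) \<le> (2 * K * \<rho>)\<^sup>2" for u y \<rho>
  proof -
    have u2: "(\<lambda>t. (norm (u t))\<^sup>2) integrable_on {0..T}"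
      using tr by (simp add: trajectory_def)
    have pt: "norm (y t - ybar) \<le> G * (1 + 2 * K) * \<rho>" if t: "t \<in> {0..T}" for t
    proof -
      have "integral {0..t} (\<lambda>t. (norm (u t))\<^sup>2) \<le> integral {0..T} (\<lambda>t. (norm (u t))\<^sup>2)"
        using t by (intro integral_subset_le u2 integrable_subinterval_real[OF u2]) auto
      then have "norm (y t - ybar) \<le> G * (norm (y 0 - ybar) + 2 * K * \<rho>)"
        using t K \<rho> u by (intro bound[where u = u] trajectory_subinterval[OF tr]) auto
      also have "\<dots> \<le> G * (\<rho> + 2 * K * \<rho>)"
        using G y0 by (intro mult_left_mono add_right_mono) auto
      finally show ?thesis by (simp add: algebra_simps)
    qed
    have "integral {0..T} (\<lambda>t. (norm (y t - ybar))\<^sup>2) \<le> integral {0..T} (\<lambda>t. (G * (1 + 2 * K) * \<rho>)\<^sup>2)"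
      by (intro integral_le trajectory_state_integrable[OF tr]) (auto intro!: power_mono pt)
    also have "\<dots> = T * (G * (1 + 2 * K))\<^sup>2 * \<rho>\<^sup>2"
      using T by (simp add: power_mult_distrib)
    finally show ?thesis
      using u energy_split[OF tr, of ybar] by (simp add: \<kappa>_def power_mult_distrib algebra_simps)
  qed
  show ?thesis
  proof
    fix x assume x: "norm (x - ybar) \<le> r"
    show "\<exists>u y. trajectory f 0 T u y \<and> y 0 = x \<and> y T = ybar \<and>
        energy ybar 0 T u y \<le> \<kappa> * (norm (x - ybar))\<^sup>2"
    \<comment> \<open>At \<open>x = ybar\<close> the strict gap between
      \<open>K * norm (x - ybar)\<close> and its double closes, so resting is used instead.\<close>
    proof (cases "x = ybar")
      case True
      then show ?thesis using trajectory_rest[where f = f and ybar = ybar, OF equilibrium, of 0 T] T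
        by - (rule exI[of _ "\<lambda>_. 0"], rule exI[of _ "\<lambda>_. ybar"], simp)
    next
      case False
      then have "Inf (steering_costs f T x ybar) < 2 * K * norm (x - ybar)"
        using to[OF x] mult_pos_pos[OF K, of "norm (x - ybar)"] by simp
      then obtain u y where "trajectory f 0 T u y" "y 0 = x" "y T = ybar"
        "integral {0..T} (\<lambda>t. (norm (u t))\<^sup>2) \<le> (2 * K * norm (x - ybar))\<^sup>2"
        using exists_near_optimal_steering[OF _ ex] T by (metis less_imp_le)
      then show ?thesis using est[of u y "norm (x - ybar)"] x by auto
    qed
    show "\<exists>u y. trajectory f 0 T u y \<and> y 0 = ybar \<and> y T = x \<and>
        energy ybar 0 T u y \<le> \<kappa> * (norm (x - ybar))\<^sup>2"
    proof (cases "x = ybar")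
      case True
      then show ?thesis using trajectory_rest[where f = f and ybar = ybar, OF equilibrium, of 0 T] T
        by - (rule exI[of _ "\<lambda>_. 0"], rule exI[of _ "\<lambda>_. ybar"], simp)
    next
      case False
      then have "Inf (steering_costs f T ybar x) < 2 * K * norm (x - ybar)"
        using fro[OF x] mult_pos_pos[OF K, of "norm (x - ybar)"] by simp
      then obtain u y where "trajectory f 0 T u y" "y 0 = ybar" "y T = x"
        "integral {0..T} (\<lambda>t. (norm (u t))\<^sup>2) \<le> (2 * K * norm (x - ybar))\<^sup>2"
        using exists_near_optimal_steering[OF _ ex] T by (metis less_imp_le)
      then show ?thesis using est[of u y "norm (x - ybar)"] x by auto
    qed
  qed (use r \<kappa> in auto)
qed

end

subsection \<open>Minimizers\<close>

lemma global_minimizer_trajectory: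
  assumes "T \<ge> 0" "global_minimizer f \<phi> ybar y0 T u y"
  shows "trajectory f 0 T u y" "y 0 = y0"
  using assms trajectory_iff[OF assms(1)] unfolding global_minimizer_def by blast+

lemma global_minimizer_le:
  assumes T: "T \<ge> 0" and min: "global_minimizer f \<phi> ybar y0 T u y"
    and vz: "trajectory f 0 T v z" "z 0 = y0"
  shows "\<phi> (y T) + energy ybar 0 T u y \<le> \<phi> (z T) + energy ybar 0 T v z"
  using min vz trajectory_iff[OF T, of v f y0 z] cost_functional_eq[OF vz(1)]
    cost_functional_eq[OF global_minimizer_trajectory(1)[OF T min]]
  unfolding global_minimizer_def by metis

text \<open>Dynamic programming: exchanging the middle piece for a competitor with the same end
  states preserves the final state and thus the terminal cost, and the energies outside the middle
  piece cancel.\<close>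

lemma global_minimizer_subinterval:
  assumes T: "T \<ge> 0" and min: "global_minimizer f \<phi> ybar y0 T u y"
    and ab: "0 \<le> a" "b \<le> T" and vz: "trajectory f a b v z" "z a = y a" "z b = y b"
  shows "energy ybar a b u y \<le> energy ybar a b v z"
proof -
  note tr = global_minimizer_trajectory[OF T min]
  have le: "a \<le> b" using vz by (simp add: trajectory_def)
  have left: "trajectory f 0 a u y" and right: "trajectory f b T u y" and aT: "trajectory f a T u y"
    using trajectory_subinterval[OF tr(1)] ab le by auto
  obtain v1 z1 where 1: "trajectory f 0 b v1 z1" "z1 0 = y 0" "z1 b = z b"
    "energy ybar 0 b v1 z1 = energy ybar 0 a u y + energy ybar a b v z"
    using trajectory_concat[OF left vz(1)] vz by metis
  obtain v2 z2 where 2: "trajectory f 0 T v2 z2" "z2 0 = y 0" "z2 T = y T"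
    "energy ybar 0 T v2 z2 = energy ybar 0 a u y + energy ybar a b v z + energy ybar b T u y"
    using trajectory_concat[OF 1(1) right] 1 vz by metis
  have "energy ybar 0 T u y = energy ybar 0 a u y + energy ybar a b u y + energy ybar b T u y"
    using energy_combine[OF tr(1), of a] energy_combine[OF aT, of b] ab le by simp
  then show ?thesis
    using global_minimizer_le[OF T min 2(1)] 2 tr(2) by simp
qed

section \<open>Exponential decay of the energy towards the middle\<close>

lemma exists_small_deviation:
  assumes tr: "trajectory f a b u y" and "a < b"
  obtains s where "s \<in> {a..b}" "(norm (y s - ybar))\<^sup>2 \<le> energy ybar a b u y / (b - a)"
proof -
  have cont: "continuous_on {a..b} (\<lambda>t. norm (y t - ybar))"
    using tr by (auto simp: trajectory_def intro!: continuous_intros)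
  \<comment> \<open>The minimum of the squared deviation is at most its mean, which the energy
    divided by the length dominates.\<close>
  obtain s where s: "s \<in> {a..b}" "\<And>t. t \<in> {a..b} \<Longrightarrow> norm (y s - ybar) \<le> norm (y t - ybar)"
    using continuous_attains_inf[OF compact_Icc _ cont] \<open>a < b\<close> by fastforce
  have "(b - a) * (norm (y s - ybar))\<^sup>2 = integral {a..b} (\<lambda>t. (norm (y s - ybar))\<^sup>2)"
    using \<open>a < b\<close> by simp
  also have "\<dots> \<le> energy ybar a b u y"
    unfolding energy_def
    by (intro integral_le trajectory_energy_integrable[OF tr])
       (auto intro!: add_increasing2 power_mono s(2))
  finally show ?thesis
    using that s(1) \<open>a < b\<close> by (simp add: field_simps)
qed

text \<open>Induction on \<open>k\<close>, cutting \<open>\<tau>\<close> off both ends in each step.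
  The condition on \<open>T\<close> leaves length at least \<open>2 * T0\<close> in the middle, as
  \<open>quasi\<close> requires; for \<open>k = 0\<close> nothing is cut and \<open>E0\<close> is
  the bound for any \<open>T\<close>.\<close>

lemma energy_decay:
  assumes tr: "trajectory f 0 T u y" and T0: "T0 > 0" and r: "r > 0" and \<kappa>: "\<kappa> > 0"
    and quasi: "\<And>a b. 0 \<le> a \<Longrightarrow> a + 2 * T0 \<le> b \<Longrightarrow> b \<le> T \<Longrightarrow> norm (y a - ybar) \<le> r \<Longrightarrow> norm (y b - ybar) \<le> r \<Longrightarrow>
        energy ybar a b u y \<le> \<kappa> * ((norm (y a - ybar))\<^sup>2 + (norm (y b - ybar))\<^sup>2)"
    and E0: "energy ybar 0 T u y \<le> E0"
    and \<tau>: "\<tau> > 0" "2 * \<kappa> \<le> \<tau>" "E0 \<le> r\<^sup>2 * \<tau>"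
  shows "k = 0 \<or> 2 * (k * \<tau>) + 2 * T0 \<le> T \<Longrightarrow> energy ybar (k * \<tau>) (T - k * \<tau>) u y \<le> E0 / 2 ^ k"
proof (induction k)
  case 0
  then show ?case using E0 by simp
next
  case (Suc k)
  define a b where "a = k * \<tau>" and "b = T - k * \<tau>"
  have T: "2 * (a + \<tau>) + 2 * T0 \<le> T" using Suc.prems by (simp add: a_def algebra_simps)
  have a0: "a \<ge> 0" using \<tau> by (simp add: a_def)
  have b: "b = T - a" by (simp add: a_def b_def)
  have F: "energy ybar a b u y \<le> E0 / 2 ^ k"
    using Suc.IH T \<tau> unfolding a_def b_def by (simp add: algebra_simps)
  have le: "a + \<tau> \<le> b - \<tau>" using T T0 b by simp
  note sub = trajectory_subinterval[OF tr]
  have tr_ab: "trajectory f a b u y" by (rule sub) (use a0 b \<tau> le in auto)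
  have tr1: "trajectory f a (a + \<tau>) u y" by (rule sub) (use a0 b \<tau> le in auto)
  have tr2: "trajectory f (b - \<tau>) b u y" by (rule sub) (use a0 b \<tau> le in auto)
  obtain p where p: "p \<in> {a..a + \<tau>}" "(norm (y p - ybar))\<^sup>2 \<le> energy ybar a (a + \<tau>) u y / \<tau>"
    using exists_small_deviation[OF tr1, of ybar] \<tau> by auto
  obtain q where q: "q \<in> {b - \<tau>..b}" "(norm (y q - ybar))\<^sup>2 \<le> energy ybar (b - \<tau>) b u y / \<tau>"
    using exists_small_deviation[OF tr2, of ybar] \<tau> by auto
  have "energy ybar a b u y = energy ybar a (a + \<tau>) u y + energy ybar (a + \<tau>) b u y"
    by (rule energy_combine[OF tr_ab]) (use \<tau> le in auto)
  moreover have "energy ybar (b - \<tau>) b u y \<le> energy ybar (a + \<tau>) b u y"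
    by (rule energy_mono[OF sub]) (use a0 b \<tau> le in auto)
  ultimately have ends: "energy ybar a (a + \<tau>) u y + energy ybar (b - \<tau>) b u y \<le> energy ybar a b u y"
    by simp
  \<comment> \<open>The condition \<open>E0 \<le> r\<^sup>2 * \<tau>\<close> puts the chosen points
    into the ball where \<open>quasi\<close> applies.\<close>
  have near: "norm (y s - ybar) \<le> r" if "(norm (y s - ybar))\<^sup>2 \<le> e / \<tau>" "e \<le> E0" for s e
  proof -
    have "(norm (y s - ybar))\<^sup>2 \<le> E0 / \<tau>"
      using that divide_right_mono[OF that(2), of \<tau>] \<tau>(1) by linarith
    also have "\<dots> \<le> r\<^sup>2" using \<tau>(1,3) by (simp add: pos_divide_le_eq)
    finally show ?thesis using r by (rule power2_le_imp_le[OF _ less_imp_le])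
  qed
  have "energy ybar a (a + \<tau>) u y \<le> E0" "energy ybar (b - \<tau>) b u y \<le> E0"
    using energy_mono[OF tr, of a "a + \<tau>" ybar] energy_mono[OF tr, of "b - \<tau>" b ybar] a0 b \<tau>(1) le E0
    by linarith+
  then have "energy ybar p q u y \<le> \<kappa> * ((norm (y p - ybar))\<^sup>2 + (norm (y q - ybar))\<^sup>2)"
    using p q a0 b T by (intro quasi near[OF p(2)] near[OF q(2)]) auto
  also have "\<dots> \<le> \<kappa> * (energy ybar a b u y / \<tau>)"
    using p(2) q(2) divide_right_mono[OF ends, of \<tau>] \<tau> \<kappa>
    by (intro mult_left_mono) (auto simp: add_divide_distrib)
  \<comment> \<open>The halving: \<open>\<kappa> / \<tau>\<close> is at most 1/2.\<close>
  also have "\<dots> \<le> energy ybar a b u y / 2"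
    using \<tau> mult_right_mono[OF \<tau>(2) energy_nonneg[of ybar a b u y]] by (simp add: field_simps)
  also have "\<dots> \<le> E0 / 2 ^ Suc k" using F by (simp add: field_simps)
  finally have "energy ybar p q u y \<le> E0 / 2 ^ Suc k" .
  moreover have "energy ybar (a + \<tau>) (b - \<tau>) u y \<le> energy ybar p q u y"
    by (rule energy_mono[OF sub]) (use p q a0 b le in auto)
  moreover have eq: "Suc k * \<tau> = a + \<tau>" "T - (a + \<tau>) = b - \<tau>"
    by (simp_all add: a_def b_def algebra_simps)
  ultimately show ?case unfolding eq by linarith
qed

section \<open>The turnpike estimate\<close>

context controlled_growth
begin

text \<open>The competitor that reaches \<open>ybar\<close> at time \<open>T0\<close> and rests
  exists for every \<open>T > T0\<close>, so \<open>T0\<close> is the threshold. On short horizons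
  the decay is used with \<open>k = 0\<close>, that is, as a uniform energy bound.\<close>

lemma turnpike:
  assumes T0: "T0 > 0" and contr: "controllable_with_cost_estimate f T0 ybar" and \<phi>: "\<And>x. \<phi> x \<ge> 0"
  shows "\<exists>C>0. \<exists>\<mu>>0. \<forall>T>T0. \<forall>u y. global_minimizer f \<phi> ybar y0 T u y \<longrightarrow>
    (\<forall>t\<in>{0..T}. norm (y t - ybar) \<le> C * (exp (- \<mu> * t) + exp (- \<mu> * (T - t)))) \<and> L2_norm T u \<le> C"
proof (rule exists_cheap_steering[OF T0 contr])
  fix r \<kappa> :: real
  assume r: "r > 0" and \<kappa>: "\<kappa> > 0"
    and to: "\<And>x. norm (x - ybar) \<le> r \<Longrightarrow> \<exists>u y. trajectory f 0 T0 u y \<and> y 0 = x \<and> y T0 = ybar \<and>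
      energy ybar 0 T0 u y \<le> \<kappa> * (norm (x - ybar))\<^sup>2"
    and fro: "\<And>x. norm (x - ybar) \<le> r \<Longrightarrow> \<exists>u y. trajectory f 0 T0 u y \<and> y 0 = ybar \<and> y T0 = x \<and>
      energy ybar 0 T0 u y \<le> \<kappa> * (norm (x - ybar))\<^sup>2"
  obtain u' y' where st: "trajectory f 0 T0 u' y'" "y' 0 = y0" "y' T0 = ybar"
  proof -
    obtain u y where "L2_control T0 u \<and> solves f T0 y0 u y" "y T0 = ybar"
      using contr unfolding controllable_with_cost_estimate_def by blast
    then show ?thesis
      using that[of u y] trajectory_iff[of T0 u f y0 y] T0 by simp
  qed
  define E0 where "E0 = \<phi> ybar + energy ybar 0 T0 u' y'"
  have E0: "E0 \<ge> 0" unfolding E0_def by (intro add_nonneg_nonneg \<phi> energy_nonneg)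
  \<comment> \<open>The entry 1 lets a division by \<open>\<tau>\<close> be dropped,
    \<open>T0\<close> makes room for the two steering phases, \<open>2 * \<kappa>\<close> gives the
    halving, and \<open>E0 / r\<^sup>2\<close> brings the chosen points within \<open>r\<close> of
    \<open>ybar\<close>.\<close>
  define \<tau> where "\<tau> = Max {1, T0, 2 * \<kappa>, E0 / r\<^sup>2}"
  have \<tau>: "\<tau> \<ge> 1" "\<tau> \<ge> T0" "2 * \<kappa> \<le> \<tau>" "E0 / r\<^sup>2 \<le> \<tau>" by (auto simp: \<tau>_def)
  then have \<tau>r: "E0 \<le> r\<^sup>2 * \<tau>" using r by (simp add: field_simps)
  obtain G where G: "G \<ge> 1"
    and bound: "\<And>a b u y q. trajectory f a b u y \<Longrightarrow> b - a \<le> \<tau> \<Longrightarrow> 0 \<le> q \<Longrightarrow> q \<le> sqrt E0 \<Longrightarrow>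
      integral {a..b} (\<lambda>t. (norm (u t))\<^sup>2) \<le> q\<^sup>2 \<Longrightarrow> norm (y b - ybar) \<le> G * (norm (y a - ybar) + q)"
    using bounded_time_bound[of \<tau> "sqrt E0"] by blast
  \<comment> \<open>\<open>D\<close> dominates the control norm, the growth out of \<open>y0\<close>
    during the first \<open>\<tau>\<close> time units, and the growth at later times; the summand 1
    makes it positive.\<close>
  define D where "D = G * (norm (y0 - ybar) + 2 * sqrt E0 + 1)"
  have D: "D > 0" "sqrt E0 \<le> D" "G * (norm (y0 - ybar) + sqrt E0) \<le> D" "2 * G * sqrt E0 \<le> D"
  proof -
    show "D > 0" using G E0 by (auto simp: D_def intro!: mult_pos_pos add_nonneg_pos)
    have "1 * sqrt E0 \<le> D" unfolding D_def using G E0 by (intro mult_mono) auto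
    then show "sqrt E0 \<le> D" by simp
    show "G * (norm (y0 - ybar) + sqrt E0) \<le> D"
      unfolding D_def using G E0 by (intro mult_left_mono) auto
    have "G * (2 * sqrt E0) \<le> D" unfolding D_def using G by (intro mult_left_mono) auto
    then show "2 * G * sqrt E0 \<le> D" by simp
  qed
  \<comment> \<open>The energy is halved every \<open>\<tau>\<close>, hence its square root decays with rate \<open>\<mu>\<close>.\<close>
  define \<mu> where "\<mu> = ln 2 / (2 * \<tau>)"
  have \<mu>: "\<mu> > 0" using \<tau> by (simp add: \<mu>_def)
  have exp2: "exp (2 * \<tau> * \<mu>) = 2" using \<tau> by (simp add: \<mu>_def)
  have half: "(exp (- \<mu> * (k * \<tau>)))\<^sup>2 = 1 / 2 ^ k" for k :: nat
  proof -
    have "(exp (- \<mu> * (k * \<tau>)))\<^sup>2 = exp (- (k * ln 2))"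
      using \<tau> by (simp add: \<mu>_def field_simps flip: exp_double)
    also have "\<dots> = 1 / 2 ^ k"
      by (simp add: exp_minus exp_of_nat_mult inverse_eq_divide)
    finally show ?thesis .
  qed
  have main: "norm (y t - ybar) \<le> 2 * D * exp (- \<mu> * min t (T - t)) \<and> L2_norm T u \<le> D"
    if T: "T > T0" and min: "global_minimizer f \<phi> ybar y0 T u y" and t: "t \<in> {0..T}" for T u y t
  proof -
    have T': "T \<ge> 0" using T T0 by simp
    note tr = global_minimizer_trajectory[OF T' min]
    note sub = trajectory_subinterval[OF tr(1)]
    have rest: "trajectory f T0 T (\<lambda>_. 0) (\<lambda>_. ybar)" "energy ybar T0 T (\<lambda>_. 0 :: real^'m) (\<lambda>_. ybar) = 0"
      using trajectory_rest[where f = f and ybar = ybar, OF equilibrium] T by auto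
    then obtain v z where vz: "trajectory f 0 T v z" "z 0 = y0" "z T = ybar"
      "energy ybar 0 T v z = energy ybar 0 T0 u' y'"
      using trajectory_concat[where ybar = ybar, OF st(1) rest(1)] st rest(2) by auto
    have total: "energy ybar 0 T u y \<le> E0"
      using global_minimizer_le[OF T' min vz(1,2)] vz \<phi>[of "y T"] by (simp add: E0_def)
    have quasi: "energy ybar a b u y \<le> \<kappa> * ((norm (y a - ybar))\<^sup>2 + (norm (y b - ybar))\<^sup>2)"
      if ab: "0 \<le> a" "a + 2 * T0 \<le> b" "b \<le> T" and near: "norm (y a - ybar) \<le> r" "norm (y b - ybar) \<le> r" for a b
    proof -
      obtain v1 z1 where 1: "trajectory f 0 T0 v1 z1" "z1 0 = y a" "z1 T0 = ybar"
        "energy ybar 0 T0 v1 z1 \<le> \<kappa> * (norm (y a - ybar))\<^sup>2"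
        using to[OF near(1)] by blast
      obtain v2 z2 where 2: "trajectory f 0 T0 v2 z2" "z2 0 = ybar" "z2 T0 = y b"
        "energy ybar 0 T0 v2 z2 \<le> \<kappa> * (norm (y b - ybar))\<^sup>2"
        using fro[OF near(2)] by blast
      have s1: "trajectory f a (a + T0) (\<lambda>t. v1 (t - a)) (\<lambda>t. z1 (t - a))"
        "energy ybar a (a + T0) (\<lambda>t. v1 (t - a)) (\<lambda>t. z1 (t - a)) = energy ybar 0 T0 v1 z1"
        using trajectory_shift[OF 1(1), where c = a] by (simp_all add: add.commute)
      have s2: "trajectory f (b - T0) b (\<lambda>t. v2 (t - (b - T0))) (\<lambda>t. z2 (t - (b - T0)))"
        "energy ybar (b - T0) b (\<lambda>t. v2 (t - (b - T0))) (\<lambda>t. z2 (t - (b - T0))) = energy ybar 0 T0 v2 z2"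
        using trajectory_shift[OF 2(1), where c = "b - T0"] by simp_all
      have 3: "trajectory f (a + T0) (b - T0) (\<lambda>_. 0) (\<lambda>_. ybar)"
        "energy ybar (a + T0) (b - T0) (\<lambda>_. 0 :: real^'m) (\<lambda>_. ybar) = 0"
        using trajectory_rest[where f = f and ybar = ybar, OF equilibrium] ab by auto
      obtain v3 z3 where 4: "trajectory f a (b - T0) v3 z3" "z3 a = y a" "z3 (b - T0) = ybar"
        "energy ybar a (b - T0) v3 z3 = energy ybar 0 T0 v1 z1"
        using trajectory_concat[where ybar = ybar, OF s1(1) 3(1)] 1 s1 3 by auto
      obtain v4 z4 where 5: "trajectory f a b v4 z4" "z4 a = y a" "z4 b = y b"
        "energy ybar a b v4 z4 = energy ybar 0 T0 v1 z1 + energy ybar 0 T0 v2 z2"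
        using trajectory_concat[where ybar = ybar, OF 4(1) s2(1)] 4 2 s2 by auto
      show ?thesis
        using global_minimizer_subinterval[OF T' min ab(1,3) 5(1-3)] 5(4) 1(4) 2(4)
        by (simp add: distrib_left)
    qed
    have "L2_norm T u \<le> sqrt E0"
      using control_le_energy[OF tr(1), of ybar] total L2_norm_eq[OF tr(1)] by simp
    then have L2: "L2_norm T u \<le> D" using D by simp
    define \<rho> where "\<rho> = min t (T - t)"
    \<comment> \<open>Losing \<open>2 * \<tau>\<close> in the exponent costs exactly the factor
      2.\<close>
    have exp_bound: "exp (- \<mu> * x) \<le> 2 * exp (- \<mu> * \<rho>)" if "\<rho> - 2 * \<tau> \<le> x" for x
    proof -
      have "exp (- \<mu> * x) \<le> exp (2 * \<tau> * \<mu> + - \<mu> * \<rho>)"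
        using mult_left_mono[OF that, of \<mu>] \<mu> by (simp add: algebra_simps)
      also have "\<dots> = 2 * exp (- \<mu> * \<rho>)" by (simp only: exp_add exp2)
      finally show ?thesis .
    qed
    have "norm (y t - ybar) \<le> 2 * D * exp (- \<mu> * \<rho>)"
    \<comment> \<open>Before time \<open>\<tau>\<close> no full piece fits to the left of
      \<open>t\<close>, so growth starts from \<open>y0\<close>; here
      \<open>\<rho> < \<tau>\<close>, and the exponential is bounded below by 1/2.\<close>
    proof (cases "t < \<tau>")
      case True
      have "energy ybar 0 t u y \<le> E0"
        using energy_mono[OF tr(1), of 0 t ybar] t total by auto
      then have "norm (y t - ybar) \<le> G * (norm (y 0 - ybar) + sqrt E0)"
        using True t E0 control_le_energy[OF sub, of 0 t ybar]
        by (intro bound[where u = u] sub) auto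
      also have "\<dots> \<le> D * exp (- \<mu> * 0)" using D tr(2) by simp
      also have "\<dots> \<le> D * (2 * exp (- \<mu> * \<rho>))"
        using D \<tau> True t by (intro mult_left_mono exp_bound) (auto simp: \<rho>_def)
      finally show ?thesis by (simp add: mult_ac)
    next
      case False
      \<comment> \<open>One less than the number of whole pieces in \<open>\<rho>\<close>, so that
        \<open>{t - \<tau>..t}\<close> stays inside the middle interval. Natural subtraction
        truncates at 0, where \<open>\<tau> \<le> t\<close> gives the inclusion. Rounding and the
        subtraction together lose at most \<open>2 * \<tau>\<close>, which \<open>exp_bound\<close>
        absorbs.\<close>
      define k where "k = nat \<lfloor>\<rho> / \<tau>\<rfloor> - 1"
      have k: "k * \<tau> \<le> t - \<tau>" "k * \<tau> \<le> T - t" "\<rho> - 2 * \<tau> \<le> k * \<tau>" "k = 0 \<or> k * \<tau> \<le> \<rho> - \<tau>"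
      proof -
        have fl: "real_of_int \<lfloor>\<rho> / \<tau>\<rfloor> \<le> \<rho> / \<tau>" "\<rho> / \<tau> < real_of_int \<lfloor>\<rho> / \<tau>\<rfloor> + 1" by linarith+
        show *: "k = 0 \<or> k * \<tau> \<le> \<rho> - \<tau>"
        proof (cases "k = 0")
          case False
          then have "real k = real_of_int \<lfloor>\<rho> / \<tau>\<rfloor> - 1" by (simp add: k_def)
          then have "real k \<le> \<rho> / \<tau> - 1" using fl by simp
          then show ?thesis using \<tau> by (simp add: field_simps)
        qed simp
        have "\<rho> / \<tau> - 2 \<le> real k" using fl by (simp add: k_def) linarith
        then show "\<rho> - 2 * \<tau> \<le> k * \<tau>" using \<tau> by (simp add: field_simps)
        show "k * \<tau> \<le> t - \<tau>" "k * \<tau> \<le> T - t"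
          using * False t \<tau> by (auto simp: \<rho>_def)
      qed
      define q where "q = sqrt E0 * exp (- \<mu> * (k * \<tau>))"
      have q: "0 \<le> q" "q \<le> sqrt E0" "q\<^sup>2 = E0 / 2 ^ k"
      proof -
        show "0 \<le> q" using E0 by (simp add: q_def)
        show "q \<le> sqrt E0" using E0 \<mu> \<tau> by (simp add: q_def mult_left_le)
        show "q\<^sup>2 = E0 / 2 ^ k" using E0 half[of k] by (simp add: q_def power_mult_distrib)
      qed
      have "energy ybar (k * \<tau>) (T - k * \<tau>) u y \<le> E0 / 2 ^ k"
        using k \<tau> \<rho>_def
        by (intro energy_decay[OF tr(1) T0 r \<kappa> quasi total _ \<tau>(3) \<tau>r]) auto
      then have F: "energy ybar a b u y \<le> q\<^sup>2" if "t - \<tau> \<le> a" "a \<le> b" "b \<le> t" for a b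
      proof -
        have "0 \<le> k * \<tau>" using \<tau> by simp
        then have "trajectory f (k * \<tau>) (T - k * \<tau>) u y"
          by (intro sub) (use \<tau>(1) k(1,2) in linarith)+
        then have "energy ybar a b u y \<le> energy ybar (k * \<tau>) (T - k * \<tau>) u y"
          by (rule energy_mono) (use k(1,2) that in linarith)+
        then show ?thesis using \<open>energy ybar (k * \<tau>) (T - k * \<tau>) u y \<le> E0 / 2 ^ k\<close> q by simp
      qed
      have "trajectory f (t - \<tau>) t u y" by (rule sub) (use False \<tau> t in auto)
      \<comment> \<open>At some time within \<open>\<tau>\<close> before \<open>t\<close> the
        deviation is at most \<open>q\<close>, and growth from there to \<open>t\<close> keeps a
        multiple of \<open>q\<close>.\<close>
      then obtain s where s: "s \<in> {t - \<tau>..t}" "(norm (y s - ybar))\<^sup>2 \<le> energy ybar (t - \<tau>) t u y / \<tau>"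
        using exists_small_deviation[of f "t - \<tau>" t u y ybar] \<tau> by auto
      have "energy ybar (t - \<tau>) t u y / \<tau> \<le> energy ybar (t - \<tau>) t u y / 1"
        using \<tau> energy_nonneg by (intro divide_left_mono) auto
      then have "(norm (y s - ybar))\<^sup>2 \<le> q\<^sup>2"
        using s(2) F[of "t - \<tau>" t] \<tau> by simp
      then have ys: "norm (y s - ybar) \<le> q" using q(1) by (rule power2_le_imp_le)
      have st: "trajectory f s t u y" by (rule sub) (use s False t in auto)
      have "norm (y t - ybar) \<le> G * (norm (y s - ybar) + q)"
        using s control_le_energy[OF st, of ybar] F[of s t] q by (intro bound[OF st]) auto
      also have "\<dots> \<le> G * (2 * q)" using G ys by (intro mult_left_mono) auto
      also have "\<dots> = 2 * G * sqrt E0 * exp (- \<mu> * (k * \<tau>))" by (simp add: q_def)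
      also have "\<dots> \<le> D * (2 * exp (- \<mu> * \<rho>))"
        using D k by (intro mult_mono exp_bound) auto
      finally show ?thesis by (simp add: mult_ac)
    qed
    then show ?thesis using L2 by (simp add: \<rho>_def)
  qed
  have D2: "2 * D > 0" using D by simp
  show ?thesis
  proof (rule exI[of _ "2 * D"], rule conjI[OF D2], rule exI[of _ \<mu>], rule conjI[OF \<mu>],
      intro conjI allI impI ballI)
    fix T u y assume T: "T > T0" and min: "global_minimizer f \<phi> ybar y0 T u y"
    then show "L2_norm T u \<le> 2 * D" using main[OF T min, of 0] T0 D by auto
    fix t assume "t \<in> {0..T}"
    then have "norm (y t - ybar) \<le> 2 * D * exp (- \<mu> * min t (T - t))" using main[OF T min] by blast
    also have "\<dots> \<le> 2 * D * (exp (- \<mu> * t) + exp (- \<mu> * (T - t)))"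
      using D by (intro mult_left_mono) (auto simp: min_def)
    finally show "norm (y t - ybar) \<le> 2 * D * (exp (- \<mu> * t) + exp (- \<mu> * (T - t)))" .
  qed
qed

end

text \<open>All Lipschitz estimates are taken from \<open>ybar\<close>. The drift vanishes there and
  contributes only the deviation; the control fields contribute their values at \<open>ybar\<close>
  as well, collected in \<open>S\<close>. The 1 in \<open>1 + L0 + S\<close> makes the constant
  positive.\<close>

lemma control_affine_growth:
  fixes f0 :: "real^'d \<Rightarrow> real^'d" and fs :: "'m::finite \<Rightarrow> real^'d \<Rightarrow> real^'d"
  assumes "\<exists>L. L-lipschitz_on UNIV f0" "\<And>j. \<exists>L. L-lipschitz_on UNIV (fs j)" "f0 ybar = 0"
  shows "\<exists>M. controlled_growth (control_affine f0 fs) ybar M"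
proof -
  obtain L0 where L0: "L0-lipschitz_on UNIV f0" using assms by blast
  obtain L where L: "\<And>j. (L j)-lipschitz_on UNIV (fs j)" using assms by metis
  define S where "S = (\<Sum>j\<in>UNIV. L j + norm (fs j ybar))"
  have Lpos: "0 \<le> L0" "0 \<le> L j" for j using L0 L lipschitz_on_nonneg by blast+
  have S: "S \<ge> 0" unfolding S_def using Lpos by (intro sum_nonneg) auto
  have "norm (control_affine f0 fs y u) \<le> (1 + L0 + S) * (norm (y - ybar) + norm u * (1 + norm (y - ybar)))" for y u
  proof -
    define n where "n = norm (y - ybar)"
    have n: "n \<ge> 0" by (simp add: n_def)
    have 0: "norm (f0 y) \<le> L0 * n"
      using lipschitz_onD[OF L0, of y ybar] assms(3) by (simp add: dist_norm n_def)
    have 1: "norm (fs j y) \<le> (L j + norm (fs j ybar)) * (1 + n)" for j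
    proof -
      have "norm (fs j y) \<le> L j * n + norm (fs j ybar)"
        using lipschitz_onD[OF L, of y ybar j] norm_triangle_ineq[of "fs j y - fs j ybar" "fs j ybar"]
        by (simp add: dist_norm n_def)
      also have "\<dots> \<le> (L j + norm (fs j ybar)) * (1 + n)"
        using n Lpos(2)[of j] by (simp add: algebra_simps)
      finally show ?thesis .
    qed
    have "norm (\<Sum>j\<in>UNIV. (u $ j) *\<^sub>R fs j y) \<le> (\<Sum>j\<in>UNIV. norm u * ((L j + norm (fs j ybar)) * (1 + n)))"
      using 1 component_le_norm_cart[of u] by (intro sum_norm_le) (auto intro!: mult_mono)
    also have "\<dots> = S * (norm u * (1 + n))"
      by (simp add: S_def sum_distrib_left sum_distrib_right mult_ac)
    finally have "norm (control_affine f0 fs y u) \<le> L0 * n + S * (norm u * (1 + n))"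
      unfolding control_affine_def using 0 by (intro norm_triangle_le add_mono)
    also have "\<dots> \<le> (1 + L0 + S) * n + (1 + L0 + S) * (norm u * (1 + n))"
      using n S Lpos by (intro add_mono mult_right_mono) auto
    finally show ?thesis by (simp add: distrib_left n_def)
  qed
  moreover have "1 + L0 + S > 0" using Lpos S by simp
  ultimately show ?thesis by (intro exI[of _ "1 + L0 + S"]) unfold_locales
qed

theorem theorem2p1:
  fixes f0 :: "real^'d \<Rightarrow> real^'d"
    and fs :: "'m::finite \<Rightarrow> real^'d \<Rightarrow> real^'d"
    and \<phi> :: "real^'d \<Rightarrow> real"
    and ybar y0 :: "real^'d"
    and T0 :: real
  assumes "\<exists>L. L-lipschitz_on UNIV f0"
    and "\<And>j. \<exists>L. L-lipschitz_on UNIV (fs j)"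
    and "f0 ybar = 0"
    and "continuous_on UNIV \<phi>"
    and "\<And>x. \<phi> x \<ge> 0"
    and "T0 > 0"
    and "controllable_with_cost_estimate (control_affine f0 fs) T0 ybar"
  shows "\<exists>Tstar>0. \<exists>C>0. \<exists>\<mu>>0. \<forall>T>Tstar. \<forall>u y.
           global_minimizer (control_affine f0 fs) \<phi> ybar y0 T u y \<longrightarrow>
             (\<forall>t\<in>{0..T}. norm (y t - ybar) \<le> C * (exp (- \<mu> * t) + exp (- \<mu> * (T - t)))) \<and>
             L2_norm T u \<le> C"
proof -
  obtain M where M: "controlled_growth (control_affine f0 fs) ybar M"
    using control_affine_growth[of f0 fs ybar] assms(1-3) by blast
  show ?thesis
    by (intro exI[of _ T0] conjI assms(6) controlled_growth.turnpike[OF M assms(6,7,5)])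
qed

end
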